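(* There exists an infinite uniformly discrete set $N\subseteq\mathbb{R}^2$ (with the metric induced from the Euclidean plane and a distinguished base point $0\in N$) such that the Lipschitz free space $\mathcal{F}(N)$ has no retractional Schauder basis.
   Context: For a metric space $(M,d)$ with distinguished point $0\in M$, $\operatorname{Lip}_0(M)$ is the Banach space of all Lipschitz functions $f:M\to\mathbb{R}$ with $f(0)=0$, with norm $\|f\|=\sup_{x\neq y}\frac{|f(x)-f(y)|}{d(x,y)}$. For $x\in M$, $\delta_x\in\operatorname{Lip}_0(M)^*$ is $\delta_x(f)=f(x)$. The Lipschitz free space is $\mathcal{F}(M)=\overline{\operatorname{span}}\{\delta_x: x\in M\}\subseteq \operatorname{Lip}_0(M)^*$ (norm closure); its dual is $\operatorname{Lip}_0(M)$. A set is uniformly discrete if $\inf_{x\ne y}d(x,y)>0$. A retraction on $M$ is a map $\varphi:M\to M$ with $\varphi(x)=x$ for all $x\in\varphi(M)$. Retractional Schauder basis: let $M$ be an infinite pointed metric space. A Schauder basis of $\mathcal{F}(M)$ with canonical projections $P_n:\mathcal{F}(M)\to\mathcal{F}(M)$, $n\in\mathbb{N}$ (onto the span of the first $n$ basis vectors) is called retractional if there exist a sequence of distinct points $\{\mu_n\}_{n=0}^\infty\subseteq M$ with $\mu_0=0$ and retractions $\varphi_n:M\to M$, $n\in\mathbb{N}_0$, such that (i) $\varphi_n(M)=\{\mu_j\}_{j=0}^n$ for every $n\in\mathbb{N}_0$; (ii) $\{\mu_j: j\in\mathbb{N}_0\}$ is dense in $M$; (iii) there exists $K>0$ such that $\varphi_n$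 is $K$-Lipschitz for every $n\in\mathbb{N}_0$; (iv) $\varphi_m\varphi_n=\varphi_n\varphi_m=\varphi_n$ for all $m,n\in\mathbb{N}_0$ with $n\leq m$; and $P_n^*f=f\circ\varphi_n$ for every $f\in\operatorname{Lip}_0(M)$ and $n\in\mathbb{N}$. *)

theory Defs
  imports "HOL-Analysis.Analysis"
begin

text \<open>
  A pointed metric space is given by a set \<open>M\<close> in a metric space together with a base
  point \<open>z \<in> M\<close>.  Functions on \<open>M\<close>, and functionals on spaces of such functions, are total HOL
  functions that vanish outside their domain, so that HOL equality is equality of elements and the
  pointwise operations are those of the vector spaces concerned.
\<close>

definition Lip0 :: "'a::metric_space set \<Rightarrow> 'a \<Rightarrow> ('a \<Rightarrow> real) set" where
  "Lip0 M z = {f. (\<exists>L. L-lipschitz_on M f) \<and> f z = 0 \<and> (\<forall>x. x \<notin> M \<longrightarrow> f x = 0)}"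

text \<open>The diagonal pairs only contribute the value \<open>0 / 0 = 0\<close> to the supremum.\<close>

definition Lip_norm :: "'a::metric_space set \<Rightarrow> ('a \<Rightarrow> real) \<Rightarrow> real" where
  "Lip_norm M f = (SUP (x, y) \<in> M \<times> M. \<bar>f x - f y\<bar> / dist x y)"

definition Lip0_dual :: "'a::metric_space set \<Rightarrow> 'a \<Rightarrow> (('a \<Rightarrow> real) \<Rightarrow> real) set" where
  "Lip0_dual M z = {\<xi>.
     (\<forall>f\<in>Lip0 M z. \<forall>g\<in>Lip0 M z. \<xi> (\<lambda>x. f x + g x) = \<xi> f + \<xi> g) \<and>
     (\<forall>c. \<forall>f\<in>Lip0 M z. \<xi> (\<lambda>x. c * f x) = c * \<xi> f) \<and>
     (\<exists>C. \<forall>f\<in>Lip0 M z. \<bar>\<xi> f\<bar> \<le> C * Lip_norm M f) \<and>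
     (\<forall>f. f \<notin> Lip0 M z \<longrightarrow> \<xi> f = 0)}"

definition dual_norm :: "'a::metric_space set \<Rightarrow> 'a \<Rightarrow> (('a \<Rightarrow> real) \<Rightarrow> real) \<Rightarrow> real" where
  "dual_norm M z \<xi> = (SUP f \<in> {f \<in> Lip0 M z. Lip_norm M f \<le> 1}. \<bar>\<xi> f\<bar>)"

definition delta :: "'a::metric_space set \<Rightarrow> 'a \<Rightarrow> 'a \<Rightarrow> ('a \<Rightarrow> real) \<Rightarrow> real" where
  "delta M z x = (\<lambda>f. if f \<in> Lip0 M z then f x else 0)"

definition delta_span :: "'a::metric_space set \<Rightarrow> 'a \<Rightarrow> (('a \<Rightarrow> real) \<Rightarrow> real) set" where
  "delta_span M z = {(\<lambda>f. \<Sum>x\<in>A. c x * delta M z x f) | A c. finite A \<and> A \<subseteq> M}"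

definition free_space :: "'a::metric_space set \<Rightarrow> 'a \<Rightarrow> (('a \<Rightarrow> real) \<Rightarrow> real) set" where
  "free_space M z = {\<xi> \<in> Lip0_dual M z.
     \<forall>e>0. \<exists>\<eta>\<in>delta_span M z. dual_norm M z (\<lambda>f. \<xi> f - \<eta> f) < e}"

text \<open>Schauder bases of a space \<open>X\<close> of real functions, with pointwise operations and norm \<open>nrm\<close>.\<close>

definition expands ::
  "(('b \<Rightarrow> real) \<Rightarrow> real) \<Rightarrow> (nat \<Rightarrow> 'b \<Rightarrow> real) \<Rightarrow> ('b \<Rightarrow> real) \<Rightarrow> (nat \<Rightarrow> real) \<Rightarrow> bool" where
  "expands nrm b x a \<longleftrightarrow> (\<lambda>n. nrm (\<lambda>t. x t - (\<Sum>i<n. a i * b i t))) \<longlonglongrightarrow> 0"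

definition Schauder_basis ::
  "(('b \<Rightarrow> real) \<Rightarrow> real) \<Rightarrow> ('b \<Rightarrow> real) set \<Rightarrow> (nat \<Rightarrow> 'b \<Rightarrow> real) \<Rightarrow> bool" where
  "Schauder_basis nrm X b \<longleftrightarrow> (\<forall>n. b n \<in> X) \<and> (\<forall>x\<in>X. \<exists>!a. expands nrm b x a)"

definition basis_projection ::
  "(('b \<Rightarrow> real) \<Rightarrow> real) \<Rightarrow> (nat \<Rightarrow> 'b \<Rightarrow> real) \<Rightarrow> nat \<Rightarrow> ('b \<Rightarrow> real) \<Rightarrow> 'b \<Rightarrow> real" where
  "basis_projection nrm b n x = (\<lambda>t. \<Sum>i<n. (THE a. expands nrm b x a) i * b i t)"

definition retraction_map :: "'a set \<Rightarrow> ('a \<Rightarrow> 'a) \<Rightarrow> bool" where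
  "retraction_map M \<phi> \<longleftrightarrow> \<phi> \<in> M \<rightarrow> M \<and> (\<forall>x \<in> \<phi> ` M. \<phi> x = x)"

text \<open>
  The vectors \<open>b 0, b 1, \<dots>\<close> are indexed from \<open>0\<close>, so \<open>basis_projection _ b n\<close> is the canonical
  projection onto the span of the first \<open>n\<close> vectors.  Under the identification of the dual of
  \<open>free_space M z\<close> with \<open>Lip0 M z\<close> through the pairing \<open>(\<xi>, f) \<mapsto> \<xi> f\<close>, the equality of the adjoint
  \<open>P\<^sub>n\<^sup>* f\<close> with \<open>f \<circ> \<phi>\<^sub>n\<close> says that \<open>(P\<^sub>n \<xi>) f = \<xi> (f \<circ> \<phi>\<^sub>n)\<close> for all \<open>\<xi>\<close>, where \<open>f \<circ> \<phi>\<^sub>n\<close> is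
  extended by \<open>0\<close> outside \<open>M\<close>.
\<close>

definition retractional_Schauder_basis ::
  "'a::metric_space set \<Rightarrow> 'a \<Rightarrow> (nat \<Rightarrow> ('a \<Rightarrow> real) \<Rightarrow> real) \<Rightarrow> bool" where
  "retractional_Schauder_basis M z b \<longleftrightarrow>
     Schauder_basis (dual_norm M z) (free_space M z) b \<and>
     (\<exists>(\<mu> :: nat \<Rightarrow> 'a) (\<phi> :: nat \<Rightarrow> 'a \<Rightarrow> 'a).
        inj \<mu> \<and> range \<mu> \<subseteq> M \<and> \<mu> 0 = z \<and>
        (\<forall>n. retraction_map M (\<phi> n)) \<and>
        (\<forall>n. \<phi> n ` M = \<mu> ` {0..n}) \<and>
        M \<subseteq> closure (range \<mu>) \<and>
        (\<exists>K>0. \<forall>n. K-lipschitz_on M (\<phi> n)) \<and>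
        (\<forall>m n. n \<le> m \<longrightarrow> (\<forall>x\<in>M. \<phi> m (\<phi> n x) = \<phi> n x \<and> \<phi> n (\<phi> m x) = \<phi> n x)) \<and>
        (\<forall>n\<ge>1. \<forall>f\<in>Lip0 M z. \<forall>\<xi>\<in>free_space M z.
           basis_projection (dual_norm M z) b n \<xi> f = \<xi> (\<lambda>x. if x \<in> M then f (\<phi> n x) else 0)))"

end

theory Submission
  imports Defs
begin

text \<open>
  Only the retractions underlying a retractional basis matter, and the obstruction to them is
  topological.  In a set that is connected through steps of length at most \<open>1\<close>, commuting
  \<open>K\<close>-Lipschitz retractions whose images grow by one point at a time send each point to places at
  distance at most \<open>K\<^sup>2 + K\<close> if one passes from one retraction to the next (\<open>consecutive_retractions_close\<close>).
  So they form a discrete homotopy from a constant map to a map fixing any prescribed finite set.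
  If the set lies in the plane and misses a square hole that is large compared with \<open>K\<close>, such a
  homotopy cannot change how often a loop winds around the hole
  (\<open>crossing_eq_coboundary\<close>, \<open>sum_cochain_homotopy_invariant\<close>).  But a constant loop has winding
  number \<open>0\<close>, while the boundary of the hole has winding number \<open>1\<close>
  (\<open>sum_crossing_square_loop\<close>).

  Since \<open>K\<close> is arbitrary, the set has to have arbitrarily large holes.  The lattice points on the
  lines of a grid whose line spacing is unbounded do this.
\<close>

section \<open>Commuting retractions onto growing finite sets\<close>

text \<open>
  The two maps differ only on the fibre over the new point \<open>\<mu> (Suc n)\<close>.  That fibre is a proper
  nonempty subset of \<open>M\<close>, so a chain from \<open>\<mu> 0\<close> enters it by a step of length at most \<open>1\<close>; the
  Lipschitz condition turns this step into a bound on the distance from \<open>\<mu> (Suc n)\<close> to the old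
  points.
\<close>

lemma consecutive_retractions_close:
  fixes M :: "'a::metric_space set" and \<phi> :: "nat \<Rightarrow> 'a \<Rightarrow> 'a"
  assumes inj: "inj \<mu>"
    and chain: "\<And>x. x \<in> M \<Longrightarrow> (\<lambda>u v. u \<in> M \<and> v \<in> M \<and> dist u v \<le> 1)\<^sup>*\<^sup>* (\<mu> 0) x"
    and retr: "\<And>n. retraction_map M (\<phi> n)"
    and image: "\<And>n. \<phi> n ` M = \<mu> ` {0..n}"
    and lip: "\<And>n. K-lipschitz_on M (\<phi> n)"
    and comm: "\<And>x. x \<in> M \<Longrightarrow> \<phi> n (\<phi> (Suc n) x) = \<phi> n x"
    and "x \<in> M"
  shows "dist (\<phi> n x) (\<phi> (Suc n) x) \<le> K * K + K"
proof -
  have fix_image: "\<phi> k (\<mu> j) = \<mu> j" if "j \<le> k" for j k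
    using retr[of k] image[of k] that unfolding retraction_map_def by auto
  have in_M: "\<phi> k y \<in> M" if "y \<in> M" for k y
    using retr[of k] that unfolding retraction_map_def by auto
  have K: "K \<ge> 0" using lip[of 0] by (rule lipschitz_on_nonneg)
  define w where "w = \<mu> (Suc n)"
  have old_or_new: "\<phi> n (\<phi> (Suc n) y) = \<phi> (Suc n) y \<or> \<phi> (Suc n) y = w" if "y \<in> M" for y
  proof -
    have "\<phi> (Suc n) y \<in> \<mu> ` {0..Suc n}" using image[of "Suc n"] that by blast
    then obtain j where j: "j \<le> Suc n" "\<phi> (Suc n) y = \<mu> j" by auto
    show ?thesis
    proof (cases "j = Suc n")
      case False
      then show ?thesis using j fix_image[of j n] by auto
    qed (use j w_def in auto)
  qed
  show ?thesis
  proof (cases "\<phi> (Suc n) x = w")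
    case False
    then have "\<phi> n x = \<phi> (Suc n) x" using old_or_new[OF \<open>x \<in> M\<close>] comm[OF \<open>x \<in> M\<close>] by simp
    then show ?thesis using K by simp
  next
    case True
    have "w \<in> M" using in_M[OF \<open>x \<in> M\<close>, of "Suc n"] True by simp
    have entry: "\<phi> (Suc n) y \<noteq> w \<or>
        (\<exists>u v. u \<in> M \<and> v \<in> M \<and> dist u v \<le> 1 \<and> \<phi> (Suc n) u \<noteq> w \<and> \<phi> (Suc n) v = w)"
      if "(\<lambda>u v. u \<in> M \<and> v \<in> M \<and> dist u v \<le> 1)\<^sup>*\<^sup>* (\<mu> 0) y" for y
      using that
    proof (induction rule: rtranclp_induct)
      case base
      then show ?case using fix_image[of 0 "Suc n"] inj by (auto simp: w_def inj_eq)
    qed blast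
    have "\<phi> (Suc n) w = w" by (simp add: w_def fix_image)
    then obtain u v where uv: "u \<in> M" "v \<in> M" "dist u v \<le> 1" "\<phi> (Suc n) u \<noteq> w" "\<phi> (Suc n) v = w"
      using entry[OF chain[OF \<open>w \<in> M\<close>]] by auto
    define q where "q = \<phi> (Suc n) u"
    have q: "q \<in> M" "\<phi> n q = q"
      using in_M old_or_new uv by (auto simp: q_def)
    have "dist q w \<le> K * dist u v"
      using lipschitz_onD[OF lip uv(1,2), of "Suc n"] uv(5) by (simp add: q_def)
    then have qw: "dist q w \<le> K" using mult_left_mono[OF uv(3) K] by simp
    have "dist (\<phi> n w) q \<le> K * dist w q"
      using lipschitz_onD[OF lip \<open>w \<in> M\<close> q(1), of n] q(2) by simp
    also have "\<dots> \<le> K * K" using qw K by (simp add: mult_left_mono dist_commute)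
    finally have "dist (\<phi> n w) w \<le> K * K + K" using qw dist_triangle[of "\<phi> n w" w q] by linarith
    then show ?thesis using True comm[OF \<open>x \<in> M\<close>] by simp
  qed
qed

section \<open>Winding around a square hole\<close>

text \<open>
  The hypothesis is the vanishing of the coboundary of \<open>c\<close> on each quadrilateral of the strip
  between the two loops; the contributions of the rungs telescope and cancel because both loops
  are closed.
\<close>

lemma sum_cochain_homotopy_invariant:
  fixes c :: "'a \<Rightarrow> 'a \<Rightarrow> int"
  assumes quad: "\<And>i. i < m \<Longrightarrow>
      c (\<alpha> i) (\<alpha> (Suc i)) + c (\<alpha> (Suc i)) (\<beta> (Suc i)) = c (\<alpha> i) (\<beta> i) + c (\<beta> i) (\<beta> (Suc i))"
    and "\<alpha> m = \<alpha> 0" "\<beta> m = \<beta> 0"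
  shows "(\<Sum>i<m. c (\<alpha> i) (\<alpha> (Suc i))) = (\<Sum>i<m. c (\<beta> i) (\<beta> (Suc i)))"
proof -
  have "(\<Sum>i<m. c (\<beta> i) (\<beta> (Suc i))) - (\<Sum>i<m. c (\<alpha> i) (\<alpha> (Suc i)))
      = (\<Sum>i<m. c (\<alpha> (Suc i)) (\<beta> (Suc i)) - c (\<alpha> i) (\<beta> i))"
    unfolding sum_subtractf[symmetric] by (rule sum.cong) (use quad in \<open>auto simp: algebra_simps\<close>)
  also have "\<dots> = 0"
    unfolding sum_lessThan_telescope[of "\<lambda>i. c (\<alpha> i) (\<beta> i)" m] using assms(2,3) by simp
  finally show ?thesis by simp
qed

text \<open>
  The signed number of times that a short step from \<open>u\<close> to \<open>v\<close> crosses the horizontal ray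
  going to the right from the centre \<open>(p, p)\<close> of the hole.
\<close>

definition crossing :: "real \<Rightarrow> real ^ 2 \<Rightarrow> real ^ 2 \<Rightarrow> int" where
  "crossing p u v =
     (if u $ 1 > p \<and> v $ 1 > p then of_bool (v $ 2 \<ge> p) - of_bool (u $ 2 \<ge> p) else 0)"

lemma crossing_self [simp]: "crossing p u u = 0"
  by (simp add: crossing_def)

text \<open>
  A set that avoids the hole and is smaller than the hole cannot surround it.  Either it lies
  entirely to the right of the centre, and being above the ray is a potential, or it does
  not reach the part of the ray outside the hole, and there are no crossings at all.
\<close>

lemma crossing_eq_coboundary:
  assumes hole: "\<And>u. u \<in> S \<Longrightarrow> \<not> (\<bar>u $ 1 - p\<bar> < r \<and> \<bar>u $ 2 - p\<bar> < r)"
    and small: "\<And>u v. u \<in> S \<Longrightarrow> v \<in> S \<Longrightarrow> dist u v < r"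
  obtains g where "\<And>u v. u \<in> S \<Longrightarrow> v \<in> S \<Longrightarrow> crossing p u v = g v - g u"
proof (cases "\<forall>u\<in>S. u $ 1 > p")
  case True
  then show ?thesis
    by (intro that[of "\<lambda>u. of_bool (u $ 2 \<ge> p)"]) (auto simp: crossing_def)
next
  case False
  then obtain w where w: "w \<in> S" "w $ 1 \<le> p" by force
  have close: "\<bar>u $ k - v $ k\<bar> < r" if "u \<in> S" "v \<in> S" for u v k
    using small[OF that] component_le_norm_cart[of "u - v" k] by (simp add: dist_norm)
  have "crossing p u v = 0" if "u \<in> S" "v \<in> S" for u v
  proof (rule ccontr)
    assume "crossing p u v \<noteq> 0"
    then have "u $ 1 > p" "(v $ 2 \<ge> p) \<noteq> (u $ 2 \<ge> p)"
      by (auto simp: crossing_def split: if_splits)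
    then have "\<bar>u $ 1 - p\<bar> < r \<and> \<bar>u $ 2 - p\<bar> < r"
      using close[OF that, of 2] close[OF that(1) w(1), of 1] w(2) by linarith
    then show False using hole[OF that(1)] by blast
  qed
  then show ?thesis by (intro that[of "\<lambda>_. 0"]) auto
qed

section \<open>Lattice points on the lines of a grid with unbounded spacing\<close>

definition lattice_point :: "nat \<Rightarrow> nat \<Rightarrow> real ^ 2" where
  "lattice_point a b = vector [real a, real b]"

lemma lattice_point_nth [simp]:
  "lattice_point a b $ 1 = real a" "lattice_point a b $ 2 = real b"
  by (simp_all add: lattice_point_def vector_2)

lemma lattice_point_eq_iff [simp]:
  "lattice_point a b = lattice_point c d \<longleftrightarrow> a = c \<and> b = d"
  by (auto simp: vec_eq_iff forall_2)

lemma dist_lattice_point_le: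
  "dist (lattice_point a b) (lattice_point c d) \<le> \<bar>real a - real c\<bar> + \<bar>real b - real d\<bar>"
  using norm_le_l1_cart[of "lattice_point a b - lattice_point c d"]
  by (simp add: dist_norm sum_2)

text \<open>
  The lines are placed at the numbers \<open>n (n + 1)\<close> because their consecutive gaps \<open>2 (n + 1)\<close> are
  unbounded and even, so that every hole is centred at a point with integer coordinates and its
  boundary meets the ray of \<open>crossing\<close> in a lattice point.
\<close>

definition grid :: "(real ^ 2) set" where
  "grid = {lattice_point a b | a b. (\<exists>n. a = n * (n + 1)) \<or> (\<exists>n. b = n * (n + 1))}"

lemma lattice_point_in_grid:
  "lattice_point a b \<in> grid \<longleftrightarrow> (\<exists>n. a = n * (n + 1)) \<or> (\<exists>n. b = n * (n + 1))"
  unfolding grid_def by auto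

lemma lattice_point_in_grid_axis [simp]: "lattice_point a 0 \<in> grid" "lattice_point 0 b \<in> grid"
  by (auto simp: lattice_point_in_grid)

lemma infinite_grid: "infinite grid"
proof -
  have "inj (\<lambda>a. lattice_point a 0)" by (auto simp: inj_def)
  then have "infinite (range (\<lambda>a. lattice_point a 0))" by (rule range_inj_infinite)
  moreover have "range (\<lambda>a. lattice_point a 0) \<subseteq> grid" by auto
  ultimately show ?thesis using finite_subset by blast
qed

lemma grid_separated:
  assumes "x \<in> grid" "y \<in> grid" "dist x y < 1"
  shows "x = y"
proof -
  obtain a b c d where xy: "x = lattice_point a b" "y = lattice_point c d"
    using assms unfolding grid_def by blast
  have "\<bar>real a - real c\<bar> < 1" "\<bar>real b - real d\<bar> < 1"
    using component_le_norm_cart[of "x - y" 1] component_le_norm_cart[of "x - y" 2] assms(3)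
    by (simp_all add: dist_norm xy)
  then have "a = c" "b = d" by linarith+
  then show ?thesis by (simp add: xy)
qed

lemma uniform_discrete_grid: "uniform_discrete grid"
  unfolding uniform_discrete_def using grid_separated zero_less_one by blast

lemma unit_step_chain:
  assumes "\<And>i. i \<le> (n::nat) \<Longrightarrow> f i \<in> M"
    and "\<And>i. i < n \<Longrightarrow> dist (f i) (f (Suc i)) \<le> 1"
  shows "(\<lambda>u v. u \<in> M \<and> v \<in> M \<and> dist u v \<le> 1)\<^sup>*\<^sup>* (f 0) (f n)"
  using assms
proof (induction n)
  case (Suc n)
  then have "(\<lambda>u v. u \<in> M \<and> v \<in> M \<and> dist u v \<le> 1)\<^sup>*\<^sup>* (f 0) (f n)" by simp
  moreover have "f n \<in> M \<and> f (Suc n) \<in> M \<and> dist (f n) (f (Suc n)) \<le> 1" using Suc.prems by simp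
  ultimately show ?case by (rule rtranclp.rtrancl_into_rtrancl)
qed simp

text \<open>
  Every point lies on a line of the grid, which leads to one of the axes, and these lead to the
  origin.
\<close>

lemma grid_chain_connected:
  assumes "x \<in> grid"
  shows "(\<lambda>u v. u \<in> grid \<and> v \<in> grid \<and> dist u v \<le> 1)\<^sup>*\<^sup>* (lattice_point 0 0) x"
    (is "?R\<^sup>*\<^sup>* _ _")
proof -
  have horizontal: "?R\<^sup>*\<^sup>* (lattice_point 0 b) (lattice_point a b)" if "\<exists>n. b = n * (n + 1)" for a b
    using that
    by (intro unit_step_chain[of a "\<lambda>i. lattice_point i b"])
       (auto simp: lattice_point_in_grid intro!: order.trans[OF dist_lattice_point_le])
  have vertical: "?R\<^sup>*\<^sup>* (lattice_point a 0) (lattice_point a b)" if "\<exists>n. a = n * (n + 1)" for a b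
    using that
    by (intro unit_step_chain[of b "\<lambda>i. lattice_point a i"])
       (auto simp: lattice_point_in_grid intro!: order.trans[OF dist_lattice_point_le])
  obtain a b where ab: "x = lattice_point a b" "(\<exists>n. a = n * (n + 1)) \<or> (\<exists>n. b = n * (n + 1))"
    using assms unfolding grid_def by blast
  have zero: "\<exists>n. (0::nat) = n * (n + 1)" by auto
  from ab(2) show ?thesis
    unfolding ab(1)
  proof
    assume "\<exists>n. a = n * (n + 1)"
    then show "?R\<^sup>*\<^sup>* (lattice_point 0 0) (lattice_point a b)"
      by (rule rtranclp_trans[OF horizontal[OF zero] vertical])
  next
    assume "\<exists>n. b = n * (n + 1)"
    then show "?R\<^sup>*\<^sup>* (lattice_point 0 0) (lattice_point a b)"
      by (rule rtranclp_trans[OF vertical[OF zero] horizontal])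
  qed
qed

lemma grid_avoids_hole:
  assumes "u \<in> grid"
  shows "\<not> (\<bar>u $ 1 - real (n * (n + 1) + (n + 1))\<bar> < real (n + 1) \<and>
            \<bar>u $ 2 - real (n * (n + 1) + (n + 1))\<bar> < real (n + 1))"
proof -
  have gap: "\<not> \<bar>real (k * (k + 1)) - real (n * (n + 1) + (n + 1))\<bar> < real (n + 1)" for k
  proof (cases "k \<le> n")
    case True
    then have "k * (k + 1) \<le> n * (n + 1)" by (intro mult_le_mono) auto
    then have "real (k * (k + 1)) \<le> real (n * (n + 1))" by (rule of_nat_mono)
    then show ?thesis unfolding of_nat_add[of "n * (n + 1)"] by linarith
  next
    case False
    then have "(n + 1) * (n + 1 + 1) \<le> k * (k + 1)" by (intro mult_le_mono) auto
    then have "n * (n + 1) + (n + 1) + (n + 1) \<le> k * (k + 1)" by (simp add: algebra_simps)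
    then have "real (n * (n + 1) + (n + 1) + (n + 1)) \<le> real (k * (k + 1))" by (rule of_nat_mono)
    then show ?thesis unfolding of_nat_add[of "n * (n + 1) + (n + 1)"] by linarith
  qed
  obtain a b where "u = lattice_point a b" "(\<exists>k. a = k * (k + 1)) \<or> (\<exists>k. b = k * (k + 1))"
    using assms unfolding grid_def by blast
  then show ?thesis using gap by (elim disjE exE) (simp_all only: lattice_point_nth, blast+)
qed

text \<open>
  The boundary of the square with lower left corner \<open>(s, s)\<close> and side \<open>2 * h\<close>, run through
  anticlockwise from that corner during the times \<open>0, \<dots>, 8 * h\<close>.
\<close>

definition square_loop :: "nat \<Rightarrow> nat \<Rightarrow> nat \<Rightarrow> real ^ 2" where
  "square_loop s h i =
     (if i \<le> 2 * h then lattice_point (s + i) s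
      else if i \<le> 4 * h then lattice_point (s + 2 * h) (s + (i - 2 * h))
      else if i \<le> 6 * h then lattice_point (s + (6 * h - i)) (s + 2 * h)
      else lattice_point s (s + (8 * h - i)))"

text \<open>The sides overlap in the corners, so that both ends of each step lie on a common side.\<close>

lemma square_loop_sides:
  "i \<le> 2 * h \<Longrightarrow> square_loop s h i = lattice_point (s + i) s"
  "2 * h \<le> i \<Longrightarrow> i \<le> 4 * h \<Longrightarrow> square_loop s h i = lattice_point (s + 2 * h) (s + (i - 2 * h))"
  "4 * h \<le> i \<Longrightarrow> i \<le> 6 * h \<Longrightarrow> square_loop s h i = lattice_point (s + (6 * h - i)) (s + 2 * h)"
  "6 * h \<le> i \<Longrightarrow> i \<le> 8 * h \<Longrightarrow> square_loop s h i = lattice_point s (s + (8 * h - i))"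
  by (auto simp: square_loop_def)

lemma square_loop_step_cases:
  assumes "i < 8 * h"
  obtains "Suc i \<le> 2 * h" | "2 * h \<le> i" "Suc i \<le> 4 * h" | "4 * h \<le> i" "Suc i \<le> 6 * h"
    | "6 * h \<le> i" "Suc i \<le> 8 * h"
  using assms by linarith

lemma dist_square_loop_Suc:
  assumes "i < 8 * h"
  shows "dist (square_loop s h i) (square_loop s h (Suc i)) \<le> 1"
  using assms
  by (cases rule: square_loop_step_cases)
     (simp_all add: square_loop_sides order.trans[OF dist_lattice_point_le])

lemma square_loop_in_grid:
  assumes "i \<le> 8 * (n + 1)"
  shows "square_loop (n * (n + 1)) (n + 1) i \<in> grid"
proof -
  define s h where "s = n * (n + 1)" and "h = n + 1"
  have "s + 2 * h = (n + 1) * (n + 1 + 1)" by (simp add: s_def h_def)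
  then have lines: "lattice_point s b \<in> grid" "lattice_point (s + 2 * h) b \<in> grid"
    "lattice_point a s \<in> grid" "lattice_point a (s + 2 * h) \<in> grid" for a b
    unfolding lattice_point_in_grid using s_def by blast+
  have "square_loop s h i \<in> grid"
    unfolding square_loop_def by (simp only: lines split: if_split) simp
  then show ?thesis by (simp only: s_def h_def)
qed

text \<open>
  The only crossing occurs halfway up the right side, at the step that starts at time
  \<open>3 * h - 1\<close>; on the left side, the loop passes the height of the centre on the wrong side of it.
\<close>

lemma sum_crossing_square_loop:
  assumes "h > 0"
  shows "(\<Sum>i<8 * h. crossing (real (s + h)) (square_loop s h i) (square_loop s h (Suc i))) = 1"
proof -
  have "crossing (real (s + h)) (square_loop s h i) (square_loop s h (Suc i))
      = (if i = 3 * h - 1 then 1 else 0)" if "i < 8 * h" for i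
    using that assms
    by (cases rule: square_loop_step_cases)
       (auto simp: square_loop_sides crossing_def simp del: of_nat_add)
  then have "(\<Sum>i<8 * h. crossing (real (s + h)) (square_loop s h i) (square_loop s h (Suc i)))
      = (\<Sum>i<8 * h. if i = 3 * h - 1 then 1 else 0)" by simp
  also have "\<dots> = 1" using assms by simp
  finally show ?thesis .
qed

section \<open>Absence of a retractional basis\<close>

theorem corollary6:
  "\<exists>(N :: (real ^ 2) set) z. infinite N \<and> uniform_discrete N \<and> z \<in> N \<and>
     \<not> (\<exists>b. retractional_Schauder_basis N z b)"
proof -
  have "\<not> retractional_Schauder_basis grid (lattice_point 0 0) b" for b
  proof
    assume "retractional_Schauder_basis grid (lattice_point 0 0) b"
    then obtain \<mu> :: "nat \<Rightarrow> real ^ 2" and \<phi> K where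
      \<mu>: "inj \<mu>" "range \<mu> \<subseteq> grid" "\<mu> 0 = lattice_point 0 0"
      and retrs: "\<forall>n. retraction_map grid (\<phi> n)"
      and images: "\<forall>n. \<phi> n ` grid = \<mu> ` {0..n}"
      and dense: "grid \<subseteq> closure (range \<mu>)"
      and lips: "\<forall>n. K-lipschitz_on grid (\<phi> n)"
      and comms: "\<forall>m n. n \<le> m \<longrightarrow> (\<forall>x\<in>grid. \<phi> m (\<phi> n x) = \<phi> n x \<and> \<phi> n (\<phi> m x) = \<phi> n x)"
      unfolding retractional_Schauder_basis_def by (elim conjE exE) (rule that)
    note retr = retrs[rule_format] and image = images[rule_format] and lip = lips[rule_format]
    have comm: "\<phi> n (\<phi> m x) = \<phi> n x" if "n \<le> m" "x \<in> grid" for m n x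
      using comms that by blast
    have K: "K \<ge> 0" using lip[of 0] by (rule lipschitz_on_nonneg)
    have in_grid: "\<phi> k y \<in> grid" if "y \<in> grid" for k y
      using retr[of k] that unfolding retraction_map_def by auto
    have move: "dist (\<phi> n x) (\<phi> (Suc n) x) \<le> K * K + K" if "x \<in> grid" for n x
    proof (rule consecutive_retractions_close
        [OF \<mu>(1) _ retr image lip comm[OF le_SucI[OF order_refl]] that])
      show "(\<lambda>u v. u \<in> grid \<and> v \<in> grid \<and> dist u v \<le> 1)\<^sup>*\<^sup>* (\<mu> 0) y" if "y \<in> grid" for y
        unfolding \<mu>(3) using that by (rule grid_chain_connected)
    qed
    \<comment> \<open>The images of two consecutive loop points under two consecutive retractions span a
      quadrilateral of diameter at most this bound, so it cannot surround the hole between the lines \<open>n\<close> and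
      \<open>n + 1\<close>.\<close>
    obtain n :: nat where n: "real n > K * K + K + K" using reals_Archimedean2 by blast
    define h where "h = n + 1"
    define s where "s = n * (n + 1)"
    define \<gamma> where "\<gamma> = square_loop s h"
    have \<gamma>_grid: "\<gamma> i \<in> grid" if "i \<le> 8 * h" for i
      using square_loop_in_grid that unfolding \<gamma>_def s_def h_def by blast
    have \<gamma>_closed: "\<gamma> (8 * h) = \<gamma> 0" by (simp add: \<gamma>_def square_loop_def)
    define winding where
      "winding k = (\<Sum>i<8 * h. crossing (real (s + h)) (\<phi> k (\<gamma> i)) (\<phi> k (\<gamma> (Suc i))))" for k
    have "winding (Suc k) = winding k" for k
      unfolding winding_def
    proof (rule sum_cochain_homotopy_invariant[symmetric, where c = "crossing (real (s + h))"
          and \<alpha> = "\<lambda>i. \<phi> k (\<gamma> i)" and \<beta> = "\<lambda>i. \<phi> (Suc k) (\<gamma> i)"])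
      fix i assume i: "i < 8 * h"
      define u u' v v' where "u = \<phi> k (\<gamma> i)" and "u' = \<phi> k (\<gamma> (Suc i))"
        and "v = \<phi> (Suc k) (\<gamma> i)" and "v' = \<phi> (Suc k) (\<gamma> (Suc i))"
      have G: "\<gamma> i \<in> grid" "\<gamma> (Suc i) \<in> grid" using \<gamma>_grid i by auto
      have step: "dist (\<phi> l (\<gamma> i)) (\<phi> l (\<gamma> (Suc i))) \<le> K" for l
      proof -
        have "dist (\<phi> l (\<gamma> i)) (\<phi> l (\<gamma> (Suc i))) \<le> K * dist (\<gamma> i) (\<gamma> (Suc i))"
          using lipschitz_onD[OF lip G] .
        also have "\<dots> \<le> K * 1"
          using dist_square_loop_Suc[OF i] K unfolding \<gamma>_def by (intro mult_left_mono)
        finally show ?thesis by simp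
      qed
      have sides: "dist u u' \<le> K" "dist v v' \<le> K" "dist u v \<le> K * K + K" "dist u' v' \<le> K * K + K"
        using step move G unfolding u_def u'_def v_def v'_def by auto
      have large: "K * K \<ge> 0" "real h > K * K + K + K"
        using n by (auto simp: h_def)
      have diagonals: "dist u v' \<le> K * K + K + K" "dist u' v \<le> K * K + K + K"
        using sides dist_triangle[of u v' u'] dist_triangle[of u' v u]
        unfolding dist_commute[of u' u] by linarith+
      have small: "dist p q < real h" if "p \<in> {u, u', v, v'}" "q \<in> {u, u', v, v'}" for p q
      proof -
        have "dist u u' < real h" "dist v v' < real h" "dist u v < real h" "dist u' v' < real h"
          "dist u v' < real h" "dist u' v < real h" "0 < real h"
          using sides diagonals large K by linarith+
        then show ?thesis
          using that by (elim insertE emptyE) (simp_all only: dist_commute dist_self)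
      qed
      have hole: "\<not> (\<bar>p $ 1 - real (s + h)\<bar> < real h \<and> \<bar>p $ 2 - real (s + h)\<bar> < real h)"
        if "p \<in> {u, u', v, v'}" for p
      proof -
        have "p \<in> grid" using that in_grid G unfolding u_def u'_def v_def v'_def by auto
        then show ?thesis unfolding s_def h_def by (rule grid_avoids_hole)
      qed
      obtain g where
        "\<And>p q. p \<in> {u, u', v, v'} \<Longrightarrow> q \<in> {u, u', v, v'} \<Longrightarrow> crossing (real (s + h)) p q = g q - g p"
        using crossing_eq_coboundary[OF hole small] by blast
      then have "crossing (real (s + h)) u u' + crossing (real (s + h)) u' v'
          = crossing (real (s + h)) u v + crossing (real (s + h)) v v'" by simp
      then show "crossing (real (s + h)) (\<phi> k (\<gamma> i)) (\<phi> k (\<gamma> (Suc i)))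
            + crossing (real (s + h)) (\<phi> k (\<gamma> (Suc i))) (\<phi> (Suc k) (\<gamma> (Suc i)))
          = crossing (real (s + h)) (\<phi> k (\<gamma> i)) (\<phi> (Suc k) (\<gamma> i))
            + crossing (real (s + h)) (\<phi> (Suc k) (\<gamma> i)) (\<phi> (Suc k) (\<gamma> (Suc i)))"
        unfolding u_def u'_def v_def v'_def .
    qed (use \<gamma>_closed in simp_all)
    then have invariant: "winding k = winding 0" for k by (induction k) auto
    have "\<phi> 0 (\<gamma> i) = \<mu> 0" if "i \<le> 8 * h" for i using image[of 0] \<gamma>_grid[OF that] by auto
    then have "winding 0 = 0" unfolding winding_def by (intro sum.neutral) simp
    moreover obtain k where "winding k = 1"
    proof -
      \<comment> \<open>In a uniformly discrete set, density of the points \<open>\<mu> j\<close> means that they exhaust it.\<close>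
      have "grid \<subseteq> range \<mu>"
      proof
        fix x assume x: "x \<in> grid"
        then obtain y where "y \<in> range \<mu>" "dist y x < 1"
          using dense closure_approachable[of x "range \<mu>"] zero_less_one by blast
        then show "x \<in> range \<mu>" using grid_separated x \<mu>(2) by blast
      qed
      then have "\<gamma> ` {..8 * h} \<subseteq> \<mu> ` UNIV" using \<gamma>_grid by blast
      then obtain J where J: "finite J" "\<gamma> ` {..8 * h} = \<mu> ` J"
        using finite_subset_image[of "\<gamma> ` {..8 * h}" \<mu> UNIV] by auto
      then obtain k where "J \<subseteq> {..k}" using finite_nat_iff_bounded_le by blast
      then have "\<gamma> ` {..8 * h} \<subseteq> \<phi> k ` grid" unfolding image J by auto
      then have "\<phi> k (\<gamma> i) = \<gamma> i" if "i \<le> 8 * h" for i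
        using retr[of k] that unfolding retraction_map_def by blast
      then have "winding k = (\<Sum>i<8 * h. crossing (real (s + h)) (\<gamma> i) (\<gamma> (Suc i)))"
        unfolding winding_def by (intro sum.cong) auto
      then show ?thesis using that sum_crossing_square_loop[of h s] by (simp add: \<gamma>_def h_def)
    qed
    ultimately show False using invariant[of k] by simp
  qed
  then show ?thesis using infinite_grid uniform_discrete_grid lattice_point_in_grid_axis(1) by blast
qed

end
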